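(* Let $d\ge1$ be an integer, let $(X_\varepsilon)_{\varepsilon>0}$ be a family of random vectors and $X$ a random vector, all defined on a probability space $(\Omega,\mathcal{F},\mathbb{P})$ and taking values in $(\mathbb{R}^d,\mathcal{B}(\mathbb{R}^d))$. Let $\varphi_\varepsilon$ and $\varphi$ denote the characteristic functions of $X_\varepsilon$ and $X$, respectively. Assume that: (i) $X_\varepsilon\to X$ in distribution as $\varepsilon\to0^+$; (ii') $\varphi\in L^2(\mathbb{R}^d)$ and $\varphi_\varepsilon\in L^2(\mathbb{R}^d)$ for each $\varepsilon>0$; (iii') $\displaystyle\limsup_{\ell\to\infty}\limsup_{\varepsilon\to0^+}\int_{\{|z|\ge\ell\}}|\varphi_\varepsilon(z)|^2\,\mathrm{d}z=0.$ Then $$\lim_{\varepsilon\to0^+}\mathrm{d}_{\mathrm{TV}}(X_\varepsilon,X)=0.$$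
   Context: The total variation distance between probability measures $\nu_1,\nu_2$ on $\mathbb{R}^d$ is $\mathrm{d}_{\mathrm{TV}}(\nu_1,\nu_2)=\inf_{\Pi}\Pi(\{(u,v):u\ne v\})$, the infimum over all couplings $\Pi$ of $\nu_1$ and $\nu_2$; $\mathrm{d}_{\mathrm{TV}}(X_\varepsilon,X)$ denotes the distance between the laws of $X_\varepsilon$ and $X$. The characteristic function of a random vector $X$ is $z\mapsto\mathbb{E}[e^{\mathsf{i}\langle z,X\rangle}]$; $|z|$ is the Euclidean norm of $z\in\mathbb{R}^d$. *)

theory Defs
  imports "HOL-Probability.Probability"
begin

definition char_vec :: "'w measure \<Rightarrow> ('w \<Rightarrow> real ^ 'd) \<Rightarrow> real ^ 'd \<Rightarrow> complex" where
  "char_vec M X z = (CLINT w|M. iexp (z \<bullet> X w))"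

text \<open>
  The library's \<^const>\<open>weak_conv_m\<close> covers only sequences of measures on the real line, so
  convergence in distribution is defined by testing against bounded continuous functions.
\<close>

definition conv_in_distr ::
  "'w measure \<Rightarrow> ('i \<Rightarrow> 'w \<Rightarrow> 'a::topological_space) \<Rightarrow> ('w \<Rightarrow> 'a) \<Rightarrow> 'i filter \<Rightarrow> bool" where
  "conv_in_distr M Xs X F \<longleftrightarrow>
     (\<forall>f :: 'a \<Rightarrow> real. continuous_on UNIV f \<longrightarrow> bounded (range f) \<longrightarrow>
        ((\<lambda>i. \<integral>w. f (Xs i w) \<partial>M) \<longlongrightarrow> (\<integral>w. f (X w) \<partial>M)) F)"

definition square_integrable :: "('a::euclidean_space \<Rightarrow> complex) \<Rightarrow> bool" where
  "square_integrable f \<longleftrightarrow>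
     f \<in> borel_measurable lborel \<and> integrable lborel (\<lambda>z. (norm (f z))\<^sup>2)"

definition couplings :: "'a measure \<Rightarrow> 'a measure \<Rightarrow> ('a \<times> 'a) measure set" where
  "couplings N1 N2 =
     {P. prob_space P \<and> sets P = sets (N1 \<Otimes>\<^sub>M N2) \<and> distr P N1 fst = N1 \<and> distr P N2 snd = N2}"

text \<open>
  The infimum is taken in the reals. For probability measures it is well behaved: the product
  measure is a coupling, and all values are nonnegative.
\<close>

definition tv_dist :: "'a measure \<Rightarrow> 'a measure \<Rightarrow> real" where
  "tv_dist N1 N2 = (INF P\<in>couplings N1 N2. measure P {p \<in> space P. fst p \<noteq> snd p})"

end

(*
  Smoothing two laws with a Gaussian of variance 1/a, Parseval's identity for the Gaussian kernel (which is
  Fubini and the Fourier transform of the Gaussian) bounds the L2 distance of the smoothed densities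
  by the L2 distance of the characteristic functions, uniformly in a. Testing against a
  continuous h and letting a tend to infinity gives, without ever constructing densities,
  2 (mu(h) - nu(h)) <= c |h|^2 + |phi - psi|^2 / c for all c > 0. By regularity of mu this extends to
  indicators of bounded Borel sets. Applied to the set A with d_TV = mu(A) - mu_eps(A) of a maximal
  coupling, it controls d_TV up to the mass of mu outside a large ball. Finally, (i) and (iii') make the L2 distance of the
  characteristic functions vanish.
*)

theory Submission
  imports Defs
begin

text \<open>A small L2 distance of densities does not make their L1 distance small on a space of
  infinite volume, so the estimate reaches total variation only through bounded sets. What lies
  outside a ball is paid for by the limit law: the maximal coupling yields the one-sided quantity
  mu(A) - nu(A), in which the mass of nu outside the ball has a favourable sign. Hence a single
  ball, chosen from mu, serves for every epsilon. The inequality with c is Cauchy-Schwarz before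
  optimising over c. With c left free, it can be fixed from the volume of the ball, after which D /
  c, with D the squared L2 distance of the characteristic functions, is made small by epsilon. The
  Gaussian kernels stay unnormalised. The squared normalisation is (a / pi)^d; compared with the
  factor (2 a)^d in Parseval's identity it leaves the Plancherel constant (2 pi)^(-d), which is
  estimated by 1.\<close>

subsection \<open>Fourier transform of the Gaussian\<close>

lemma gaussian_fourier_real:
  fixes b x :: real
  assumes b: "b > 0"
  shows "has_bochner_integral lborel (\<lambda>z. iexp (z * x) * exp (- (b * z\<^sup>2)))
           (complex_of_real (sqrt (pi / b) * exp (- (x\<^sup>2 / (4 * b)))))"
proof -
  \<comment> \<open>The substitution y = c z turns the exponent y^2 / 2 of the standard normal
    density into b z^2, and the frequency x into x / c.\<close>
  define c where "c = sqrt (2 * b)"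
  have c: "c > 0" and c2: "c\<^sup>2 = 2 * b" using b by (auto simp: c_def)
  have int: "has_bochner_integral lborel (\<lambda>y. std_normal_density y *\<^sub>R iexp (x / c * y))
      (complex_of_real (exp (- ((x / c)\<^sup>2) / 2)))"
  proof -
    have "(\<lambda>y. std_normal_density y *\<^sub>R iexp (x / c * y)) \<in> borel_measurable lborel" by simp
    then have 1: "integrable lborel (\<lambda>y. std_normal_density y *\<^sub>R iexp (x / c * y))"
      by (rule Bochner_Integration.integrable_bound[OF integrable_normal_density[of 1 0], rotated])
         (simp_all add: norm_mult)
    have "(\<integral>y. std_normal_density y *\<^sub>R iexp (x / c * y) \<partial>lborel) = char std_normal_distribution (x / c)"
      unfolding char_def by (subst integral_density) (auto simp: normal_density_nonneg)
    with 1 show ?thesis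
      by (simp add: has_bochner_integral_iff char_std_normal_distribution)
  qed
  have "has_bochner_integral lborel (\<lambda>z. std_normal_density (0 + c * z) *\<^sub>R iexp (x / c * (0 + c * z)))
      (complex_of_real (exp (- ((x / c)\<^sup>2) / 2)) /\<^sub>R \<bar>c\<bar>)"
    using int c by (subst lborel_has_bochner_integral_real_affine_iff[of c, symmetric]) auto
  then have "has_bochner_integral lborel
      (\<lambda>z. sqrt (2 * pi) *\<^sub>R (std_normal_density (0 + c * z) *\<^sub>R iexp (x / c * (0 + c * z))))
      (sqrt (2 * pi) *\<^sub>R (complex_of_real (exp (- ((x / c)\<^sup>2) / 2)) /\<^sub>R \<bar>c\<bar>))"
    by (rule has_bochner_integral_scaleR_right)
  moreover have "sqrt (2 * pi) *\<^sub>R (std_normal_density (0 + c * z) *\<^sub>R iexp (x / c * (0 + c * z)))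
      = iexp (z * x) * exp (- (b * z\<^sup>2))" for z
  proof -
    have "- ((c * z)\<^sup>2) / 2 = - (b * z\<^sup>2)" by (simp add: power_mult_distrib c2)
    moreover have "x / c * (c * z) = z * x" using c by simp
    ultimately show ?thesis by (simp add: std_normal_density_def scaleR_conv_of_real)
  qed
  moreover have "sqrt (2 * pi) *\<^sub>R (complex_of_real (exp (- ((x / c)\<^sup>2) / 2)) /\<^sub>R \<bar>c\<bar>)
      = complex_of_real (sqrt (pi / b) * exp (- (x\<^sup>2 / (4 * b))))"
  proof -
    have "sqrt (2 * pi) / c = sqrt (pi / b)"
      by (simp add: c_def real_sqrt_divide[symmetric])
    moreover have "- ((x / c)\<^sup>2) / 2 = - (x\<^sup>2 / (4 * b))"
      by (simp add: power_divide c2)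
    ultimately have "sqrt (2 * pi) * (exp (- ((x / c)\<^sup>2) / 2) / \<bar>c\<bar>) = sqrt (pi / b) * exp (- (x\<^sup>2 / (4 * b)))"
      using c by (simp add: field_simps)
    then show ?thesis
      by (simp only: scaleR_conv_of_real divide_inverse mult.commute flip: of_real_mult)
  qed
  ultimately show ?thesis by simp
qed

text \<open>Lebesgue measure is the image of the product of one-dimensional Lebesgue measures under
  the map from coordinates to vectors, so integrals of products of one-coordinate functions
  factorise.\<close>

lemma has_bochner_integral_lborel_prod:
  fixes f :: "'a::euclidean_space \<Rightarrow> real \<Rightarrow> complex"
  assumes "\<And>i. i \<in> Basis \<Longrightarrow> has_bochner_integral lborel (f i) (I i)"
  shows "has_bochner_integral lborel (\<lambda>z::'a. \<Prod>i\<in>Basis. f i (z \<bullet> i)) (\<Prod>i\<in>Basis. I i)"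
proof -
  interpret product_sigma_finite "\<lambda>_::'a. lborel :: real measure" by standard
  have int: "integrable lborel (f i)" and I: "integral\<^sup>L lborel (f i) = I i" if "i \<in> Basis" for i
    using assms[OF that] by (auto simp: has_bochner_integral_iff)
  have [measurable]: "f i \<in> borel_measurable borel" if "i \<in> Basis" for i
    using borel_measurable_integrable[OF int[OF that]] by simp
  have m: "(\<lambda>f. \<Sum>b\<in>Basis. f b *\<^sub>R b) \<in> (\<Pi>\<^sub>M b\<in>(Basis::'a set). lborel) \<rightarrow>\<^sub>M borel" by measurable
  have P: "has_bochner_integral (\<Pi>\<^sub>M b\<in>(Basis::'a set). lborel) (\<lambda>x. \<Prod>i\<in>Basis. f i (x i)) (\<Prod>i\<in>Basis. I i)"
    unfolding has_bochner_integral_iff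
    by (simp add: product_integrable_prod product_integral_prod int I cong: prod.cong)
  have eq: "(\<Prod>i\<in>Basis. f i (x i)) = (\<Prod>i\<in>Basis. f i ((\<Sum>b\<in>Basis. x b *\<^sub>R b) \<bullet> i))" for x :: "'a \<Rightarrow> real"
    by (intro prod.cong refl) simp
  show ?thesis
    unfolding lborel_eq[where 'a='a]
    by (rule has_bochner_integral_distr[OF _ m]) (use P in \<open>simp_all only: eq[symmetric], measurable\<close>)
qed

lemma gaussian_fourier:
  fixes x :: "'a::euclidean_space"
  assumes b: "b > 0"
  shows "has_bochner_integral lborel (\<lambda>z. iexp (z \<bullet> x) * exp (- (b * (norm z)\<^sup>2)))
           (complex_of_real (sqrt (pi / b) ^ DIM('a) * exp (- ((norm x)\<^sup>2 / (4 * b)))))"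
proof -
  have n: "(norm z)\<^sup>2 = (\<Sum>i\<in>Basis. (z \<bullet> i)\<^sup>2)" for z :: 'a
    by (simp add: norm_eq_sqrt_inner euclidean_inner[of z z] power2_eq_square sum_nonneg)
  have 1: "(\<Prod>i\<in>Basis. iexp (z \<bullet> i * (x \<bullet> i)) * exp (- (b * (z \<bullet> i)\<^sup>2))) =
      iexp (z \<bullet> x) * exp (- (b * (norm z)\<^sup>2))" for z
    by (simp add: prod.distrib exp_sum n euclidean_inner[of z x] sum_distrib_left
        sum_negf[symmetric])
  have 2: "(\<Prod>i\<in>Basis. complex_of_real (sqrt (pi / b) * exp (- ((x \<bullet> i)\<^sup>2 / (4 * b))))) =
     complex_of_real (sqrt (pi / b) ^ DIM('a) * exp (- ((norm x)\<^sup>2 / (4 * b))))"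
    by (simp add: prod.distrib exp_sum n sum_divide_distrib sum_negf[symmetric])
  show ?thesis
    using has_bochner_integral_lborel_prod[OF gaussian_fourier_real[OF b], of "\<lambda>i. x \<bullet> i"]
    unfolding 1 2 .
qed

lemma gaussian_integral:
  assumes b: "b > 0"
  shows "has_bochner_integral lborel (\<lambda>z::'a::euclidean_space. exp (- (b * (norm z)\<^sup>2)))
           (sqrt (pi / b) ^ DIM('a))"
proof -
  have "has_bochner_integral lborel (\<lambda>z::'a. complex_of_real (exp (- (b * (norm z)\<^sup>2))))
           (complex_of_real (sqrt (pi / b) ^ DIM('a)))"
    using gaussian_fourier[OF b, of "0::'a"] by simp
  from has_bochner_integral_Re[OF this] show ?thesis by simp
qed

lemma gaussian_integral_shift:
  assumes b: "b > 0"
  shows "has_bochner_integral lborel (\<lambda>z::'a::euclidean_space. exp (- (b * (norm (z - x))\<^sup>2)))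
           (sqrt (pi / b) ^ DIM('a))"
proof -
  have "has_bochner_integral (distr lborel borel ((+) x)) (\<lambda>z::'a. exp (- (b * (norm (z - x))\<^sup>2)))
           (sqrt (pi / b) ^ DIM('a))"
    using gaussian_integral[OF b, where 'a='a]
    by (intro has_bochner_integral_distr) auto
  then show ?thesis by (simp add: lborel_distr_plus)
qed

subsection \<open>Parseval's identity for Gaussian smoothings\<close>

text \<open>Up to the factor (a / pi)^(d/2), this is the density of the law convolved with a centred
  Gaussian of variance 1 / (2 a) in each coordinate.\<close>

definition gauss_smooth :: "real \<Rightarrow> 'a::euclidean_space measure \<Rightarrow> 'a \<Rightarrow> real" where
  "gauss_smooth a \<mu> u = (\<integral>x. exp (- (a * (norm (x - u))\<^sup>2)) \<partial>\<mu>)"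

text \<open>The parallelogram law for x - u and y - u. It splits a product of two Gaussian kernels
  in u into a factor depending on x - y only and one Gaussian centred at the midpoint.\<close>

lemma norm_Pythagoras_midpoint:
  fixes x y u :: "'a::real_inner"
  shows "(norm (x - u))\<^sup>2 + (norm (y - u))\<^sup>2 =
     (norm (x - y))\<^sup>2 / 2 + 2 * (norm (u - (x + y) /\<^sub>R 2))\<^sup>2"
  by (simp add: power2_norm_eq_inner inner_diff_left inner_diff_right inner_add_left inner_add_right
      inner_commute field_simps)

lemma (in pair_prob_space) integral_mult_pair:
  fixes f g :: "_ \<Rightarrow> 'c::{real_normed_field, banach, second_countable_topology}"
  assumes "integrable M1 f" "integrable M2 g"
  shows "(\<integral>p. f (fst p) * g (snd p) \<partial>(M1 \<Otimes>\<^sub>M M2)) = integral\<^sup>L M1 f * integral\<^sup>L M2 g"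
proof -
  have [measurable]: "f \<in> borel_measurable M1" "g \<in> borel_measurable M2"
    using assms by auto
  have "integrable (M1 \<Otimes>\<^sub>M M2) (\<lambda>p. f (fst p) * g (snd p))"
    using assms by (intro Fubini_integrable) (auto simp: norm_mult)
  from integral_fst'[OF this] show ?thesis by simp
qed

text \<open>Fubini in the shape that recurs below: the inner integral over the second factor has a
  given value for each p, and the averages over p are to be integrated.\<close>

lemma (in pair_sigma_finite) has_bochner_integral_Fubini:
  fixes F :: "_ \<Rightarrow> _ \<Rightarrow> _::{banach, second_countable_topology}"
  assumes "case_prod F \<in> borel_measurable (M1 \<Otimes>\<^sub>M M2)"
    and "\<And>p. has_bochner_integral M2 (F p) (I p)"
    and "integrable M1 (\<lambda>p. \<integral>u. norm (F p u) \<partial>M2)"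
  shows "has_bochner_integral M2 (\<lambda>u. \<integral>p. F p u \<partial>M1) (\<integral>p. I p \<partial>M1)"
proof -
  have int: "integrable (M1 \<Otimes>\<^sub>M M2) (case_prod F)"
    using assms by (intro Fubini_integrable) (auto simp: has_bochner_integral_iff)
  have "I p = (\<integral>u. F p u \<partial>M2)" for p
    using assms(2)[of p] by (simp add: has_bochner_integral_iff)
  with Fubini_integral[OF int] integrable_snd[OF int] show ?thesis
    by (simp add: has_bochner_integral_iff)
qed

context
  fixes \<mu> \<nu> :: "'a::euclidean_space measure"
  assumes prob: "prob_space \<mu>" "prob_space \<nu>"
    and sets: "sets \<mu> = sets borel" "sets \<nu> = sets borel"
begin

interpretation mu: prob_space \<mu> by (rule prob)
interpretation nu: prob_space \<nu> by (rule prob)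
interpretation Q: pair_prob_space \<mu> \<nu> by standard
interpretation QL: pair_sigma_finite "\<mu> \<Otimes>\<^sub>M \<nu>" "lborel :: 'a measure" by standard

text \<open>Parseval's identity is proved by evaluating both of its sides as a double integral of a
  Gaussian in x - y. This is the spatial side: after Fubini, the Gaussian at the midpoint has
  exponent 2 a and integrates to the prefactor.\<close>

lemma integral_gauss_smooth_mult:
  notes sets [measurable_cong]
  assumes a: "a > 0"
  shows "has_bochner_integral lborel (\<lambda>u. gauss_smooth a \<mu> u * gauss_smooth a \<nu> u)
    (sqrt (pi / (2 * a)) ^ DIM('a) * (\<integral>p. exp (- (a / 2 * (norm (fst p - snd p))\<^sup>2)) \<partial>(\<mu> \<Otimes>\<^sub>M \<nu>)))"
proof -
  define F where "F p u = exp (- (a * (norm (fst p - u))\<^sup>2)) * exp (- (a * (norm (snd p - u))\<^sup>2))"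
    for p :: "'a \<times> 'a" and u :: 'a
  define I where "I p = exp (- (a / 2 * (norm (fst p - snd p))\<^sup>2)) * sqrt (pi / (2 * a)) ^ DIM('a)"
    for p :: "'a \<times> 'a"
  have F: "F p u = exp (- (a / 2 * (norm (fst p - snd p))\<^sup>2)) *
      exp (- (2 * a * (norm (u - (fst p + snd p) /\<^sub>R 2))\<^sup>2))" for p u
  proof -
    have "F p u = exp (- (a * ((norm (fst p - u))\<^sup>2 + (norm (snd p - u))\<^sup>2)))"
      by (simp add: F_def algebra_simps flip: exp_add)
    then show ?thesis
      unfolding norm_Pythagoras_midpoint by (simp add: algebra_simps flip: exp_add)
  qed
  have hF: "has_bochner_integral lborel (F p) (I p)" for p
    unfolding F I_def using a
    by (intro has_bochner_integral_mult_right gaussian_integral_shift) auto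
  have nF: "(\<integral>u. norm (F p u) \<partial>lborel) = I p" for p
  proof -
    have "norm (F p u) = F p u" for u by (simp add: F_def)
    with hF[of p] show ?thesis by (simp add: has_bochner_integral_iff)
  qed
  have "has_bochner_integral lborel (\<lambda>u. \<integral>p. F p u \<partial>(\<mu> \<Otimes>\<^sub>M \<nu>)) (\<integral>p. I p \<partial>(\<mu> \<Otimes>\<^sub>M \<nu>))"
  proof (rule QL.has_bochner_integral_Fubini[OF _ hF])
    show "case_prod F \<in> borel_measurable ((\<mu> \<Otimes>\<^sub>M \<nu>) \<Otimes>\<^sub>M lborel)"
      unfolding F_def by measurable
    show "integrable (\<mu> \<Otimes>\<^sub>M \<nu>) (\<lambda>p. \<integral>u. norm (F p u) \<partial>lborel)"
      unfolding nF I_def using a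
      by (intro integrable_mult_left Q.P.integrable_const_bound[where B=1]) auto
  qed
  moreover have "(\<integral>p. F p u \<partial>(\<mu> \<Otimes>\<^sub>M \<nu>)) = gauss_smooth a \<mu> u * gauss_smooth a \<nu> u" for u
    unfolding F_def gauss_smooth_def using a
    by (intro Q.integral_mult_pair[of "\<lambda>x. exp (- (a * (norm (x - u))\<^sup>2))" "\<lambda>x. exp (- (a * (norm (x - u))\<^sup>2))"]
        mu.integrable_const_bound[where B=1] nu.integrable_const_bound[where B=1]) auto
  ultimately show ?thesis by (simp add: I_def mult.commute)
qed

end

context
  fixes \<mu> \<nu> :: "(real ^ 'd) measure"
  assumes prob: "prob_space \<mu>" "prob_space \<nu>"
    and sets: "sets \<mu> = sets borel" "sets \<nu> = sets borel"
begin

interpretation mu: prob_space \<mu> by (rule prob)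
interpretation nu: prob_space \<nu> by (rule prob)
interpretation Q: pair_prob_space \<mu> \<nu> by standard
interpretation QL: pair_sigma_finite "\<mu> \<Otimes>\<^sub>M \<nu>" "lborel :: (real ^ 'd) measure" by standard

text \<open>The frequency side: phi(z) times the conjugate of psi(z) is the average of exp(i <z, x -
  y>) over independent x and y. The factor exp(-b |z|^2) gives the absolute integrability for
  Fubini, whether or not phi and psi are in L2.\<close>

lemma integral_char_vec_mult:
  notes sets [measurable_cong]
  assumes b: "b > 0"
  shows "has_bochner_integral lborel
    (\<lambda>z. char_vec \<mu> (\<lambda>x. x) z * cnj (char_vec \<nu> (\<lambda>x. x) z) * exp (- (b * (norm z)\<^sup>2)))
    (complex_of_real (sqrt (pi / b) ^ CARD('d) *
       (\<integral>p. exp (- ((norm (fst p - snd p))\<^sup>2 / (4 * b))) \<partial>(\<mu> \<Otimes>\<^sub>M \<nu>))))"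
proof -
  define F where "F p z = iexp (z \<bullet> (fst p - snd p)) * exp (- (b * (norm z)\<^sup>2))"
    for p :: "(real ^ 'd) \<times> (real ^ 'd)" and z :: "real ^ 'd"
  define I where "I p = complex_of_real (sqrt (pi / b) ^ CARD('d) * exp (- ((norm (fst p - snd p))\<^sup>2 / (4 * b))))"
    for p :: "(real ^ 'd) \<times> (real ^ 'd)"
  have hF: "has_bochner_integral lborel (F p) (I p)" for p
    unfolding F_def I_def using gaussian_fourier[OF b, of "fst p - snd p"] by simp
  have nF: "norm (F p z) = exp (- (b * (norm z)\<^sup>2))" for p z
    by (simp add: F_def norm_mult)
  have "has_bochner_integral lborel (\<lambda>u. \<integral>p. F p u \<partial>(\<mu> \<Otimes>\<^sub>M \<nu>)) (\<integral>p. I p \<partial>(\<mu> \<Otimes>\<^sub>M \<nu>))"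
  proof (rule QL.has_bochner_integral_Fubini[OF _ hF])
    show "case_prod F \<in> borel_measurable ((\<mu> \<Otimes>\<^sub>M \<nu>) \<Otimes>\<^sub>M lborel)"
      unfolding F_def by measurable
    show "integrable (\<mu> \<Otimes>\<^sub>M \<nu>) (\<lambda>p. \<integral>u. norm (F p u) \<partial>lborel)"
      unfolding nF by simp
  qed
  moreover have "(\<integral>p. F p z \<partial>(\<mu> \<Otimes>\<^sub>M \<nu>)) =
      char_vec \<mu> (\<lambda>x. x) z * cnj (char_vec \<nu> (\<lambda>x. x) z) * exp (- (b * (norm z)\<^sup>2))" for z
  proof -
    have "F p z = iexp (z \<bullet> fst p) * cnj (iexp (z \<bullet> snd p)) * exp (- (b * (norm z)\<^sup>2))" for p
      by (simp add: F_def inner_diff_right exp_cnj algebra_simps flip: exp_add)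
    then have "(\<integral>p. F p z \<partial>(\<mu> \<Otimes>\<^sub>M \<nu>)) =
       (\<integral>p. iexp (z \<bullet> fst p) * cnj (iexp (z \<bullet> snd p)) \<partial>(\<mu> \<Otimes>\<^sub>M \<nu>)) * exp (- (b * (norm z)\<^sup>2))"
      by simp
    also have "(\<integral>p. iexp (z \<bullet> fst p) * cnj (iexp (z \<bullet> snd p)) \<partial>(\<mu> \<Otimes>\<^sub>M \<nu>)) =
        (\<integral>x. iexp (z \<bullet> x) \<partial>\<mu>) * (\<integral>x. cnj (iexp (z \<bullet> x)) \<partial>\<nu>)"
      by (intro Q.integral_mult_pair[of "\<lambda>x. iexp (z \<bullet> x)" "\<lambda>x. cnj (iexp (z \<bullet> x))"]
        mu.integrable_const_bound[where B=1] nu.integrable_const_bound[where B=1])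
         (auto simp del: exp_cnj intro!: borel_measurable_continuous_on[where f=cnj] continuous_intros)
    finally show ?thesis by (simp add: char_vec_def del: exp_cnj)
  qed
  moreover have "(\<integral>p. I p \<partial>(\<mu> \<Otimes>\<^sub>M \<nu>)) = complex_of_real (sqrt (pi / b) ^ CARD('d) *
       (\<integral>p. exp (- ((norm (fst p - snd p))\<^sup>2 / (4 * b))) \<partial>(\<mu> \<Otimes>\<^sub>M \<nu>)))"
    unfolding I_def integral_complex_of_real by simp
  ultimately show ?thesis by simp
qed

text \<open>The two double integrals agree when 1 / (4 b) = a / 2, that is for b = 1 / (2 a). The
  real part suffices because only Re occurs in the cross term of |phi - psi|^2.\<close>

lemma Parseval_gauss_smooth:
  assumes a: "a > 0"
  shows "has_bochner_integral lborel
    (\<lambda>z. Re (char_vec \<mu> (\<lambda>x. x) z * cnj (char_vec \<nu> (\<lambda>x. x) z)) * exp (- ((norm z)\<^sup>2 / (2 * a))))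
    ((2 * a) ^ CARD('d) * (\<integral>u. gauss_smooth a \<mu> u * gauss_smooth a \<nu> u \<partial>lborel))"
proof -
  define E where "E = (\<integral>p. exp (- (a / 2 * (norm (fst p - snd p))\<^sup>2)) \<partial>(\<mu> \<Otimes>\<^sub>M \<nu>))"
  \<comment> \<open>The ratio of the prefactors on the two sides is (2 a)^d, since pi / b = 2 a pi =
    (2 a)^2 * (pi / (2 a)).\<close>
  have "sqrt (pi / (1 / (2 * a))) ^ CARD('d) = (2 * a) ^ CARD('d) * sqrt (pi / (2 * a)) ^ CARD('d)"
  proof -
    have "sqrt (pi / (1 / (2 * a))) = sqrt ((2 * a)\<^sup>2 * (pi / (2 * a)))"
      using a by (simp add: power2_eq_square field_simps)
    also have "\<dots> = 2 * a * sqrt (pi / (2 * a))"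
      using a by (simp only: real_sqrt_mult real_sqrt_abs abs_of_pos zero_less_mult_iff zero_less_numeral simp_thms)
    finally show ?thesis by (simp add: power_mult_distrib)
  qed
  then have "has_bochner_integral lborel
    (\<lambda>z. char_vec \<mu> (\<lambda>x. x) z * cnj (char_vec \<nu> (\<lambda>x. x) z) * exp (- ((norm z)\<^sup>2 / (2 * a))))
    (complex_of_real ((2 * a) ^ CARD('d) * sqrt (pi / (2 * a)) ^ CARD('d) * E))"
    using integral_char_vec_mult[of "1 / (2 * a)"] a by (simp add: E_def mult.commute)
  from has_bochner_integral_Re[OF this] show ?thesis
    using integral_gauss_smooth_mult[OF prob sets a] by (simp add: E_def has_bochner_integral_iff algebra_simps)
qed

end

subsection \<open>Test functions\<close>

text \<open>An approximate identity. The parameter runs through squares a = s^2, so that the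
  substitution u = x + v / s carries all dependence on n into the argument of h, and dominated
  convergence applies.\<close>

lemma gauss_mollifier_tendsto:
  fixes h :: "'a::euclidean_space \<Rightarrow> real"
  assumes h: "continuous_on UNIV h" and B: "\<And>x. \<bar>h x\<bar> \<le> B"
  shows "(\<lambda>n. sqrt ((real (Suc n))\<^sup>2 / pi) ^ DIM('a) *
     (\<integral>u. h u * exp (- ((real (Suc n))\<^sup>2 * (norm (x - u))\<^sup>2)) \<partial>lborel)) \<longlonglongrightarrow> h x"
proof -
  let ?s = "\<lambda>n. real (Suc n)"
  define k where "k = sqrt (1 / pi) ^ DIM('a)"
  have hm [measurable]: "h \<in> borel_measurable borel"
    using h by (rule borel_measurable_continuous_onI)
  have eq: "sqrt ((?s n)\<^sup>2 / pi) ^ DIM('a) * (\<integral>u. h u * exp (- ((?s n)\<^sup>2 * (norm (x - u))\<^sup>2)) \<partial>lborel) =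
      k * (\<integral>v. h (x + inverse (?s n) *\<^sub>R v) * exp (- ((norm v)\<^sup>2)) \<partial>lborel)" for n
  proof -
    have "(\<integral>u. h u * exp (- ((?s n)\<^sup>2 * (norm (x - u))\<^sup>2)) \<partial>lborel) =
       inverse (?s n) ^ DIM('a) * (\<integral>v. h (x + inverse (?s n) *\<^sub>R v) *
          exp (- ((?s n)\<^sup>2 * (norm (x - (x + inverse (?s n) *\<^sub>R v)))\<^sup>2)) \<partial>lborel)"
      by (subst lborel_affine[of "inverse (?s n)" x])
         (simp_all add: integral_density integral_distr abs_mult power_abs)
    moreover have "(?s n)\<^sup>2 * (norm (x - (x + inverse (?s n) *\<^sub>R v)))\<^sup>2 = (norm v)\<^sup>2" for v
      by (simp add: power_mult_distrib[symmetric] del: of_nat_Suc)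
    ultimately show ?thesis
      by (simp only:) (simp add: k_def real_sqrt_divide power_divide field_simps del: of_nat_Suc)
  qed
  have "(\<lambda>n. \<integral>v. h (x + inverse (?s n) *\<^sub>R v) * exp (- ((norm v)\<^sup>2)) \<partial>lborel) \<longlonglongrightarrow>
        (\<integral>v. h (x + 0 *\<^sub>R v) * exp (- ((norm v)\<^sup>2)) \<partial>lborel)"
  proof (rule integral_dominated_convergence[where w="\<lambda>v. B * exp (- ((norm v)\<^sup>2))"])
    show "integrable lborel (\<lambda>v::'a. B * exp (- ((norm v)\<^sup>2)))"
      using gaussian_integral[of 1, where 'a='a] by (simp add: has_bochner_integral_iff)
    have "isCont h x" for x using h by (simp add: continuous_on_eq_continuous_at)
    then show "AE v in lborel. (\<lambda>n. h (x + inverse (?s n) *\<^sub>R v) * exp (- ((norm v)\<^sup>2)))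
        \<longlonglongrightarrow> h (x + 0 *\<^sub>R v) * exp (- ((norm v)\<^sup>2))"
      by (intro AE_I2 tendsto_intros isCont_tendsto_compose[of _ h] LIMSEQ_inverse_real_of_nat)
    show "AE v in lborel. norm (h (x + inverse (?s n) *\<^sub>R v) * exp (- ((norm v)\<^sup>2))) \<le> B * exp (- ((norm v)\<^sup>2))" for n
      using B by (intro AE_I2) (simp add: abs_mult)
    show "(\<lambda>v. h (x + 0 *\<^sub>R v) * exp (- ((norm v)\<^sup>2))) \<in> borel_measurable lborel"
      by measurable
    show "(\<lambda>v. h (x + inverse (?s n) *\<^sub>R v) * exp (- ((norm v)\<^sup>2))) \<in> borel_measurable lborel" for n
      by measurable
  qed
  also have "(\<integral>v. h (x + 0 *\<^sub>R v) * exp (- ((norm v)\<^sup>2)) \<partial>lborel) = h x * sqrt pi ^ DIM('a)"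
    using gaussian_integral[of 1, where 'a='a] by (simp add: has_bochner_integral_iff)
  finally have "(\<lambda>n. k * (\<integral>v. h (x + inverse (?s n) *\<^sub>R v) * exp (- ((norm v)\<^sup>2)) \<partial>lborel))
     \<longlonglongrightarrow> k * (h x * sqrt pi ^ DIM('a))"
    by (intro tendsto_intros)
  moreover have "k * (h x * sqrt pi ^ DIM('a)) = h x"
    by (simp add: k_def real_sqrt_divide power_divide)
  ultimately show ?thesis unfolding eq by simp
qed

text \<open>The kernel is symmetric in x and u, so smoothing can be moved from the law to the test
  function.\<close>

lemma integral_gauss_smooth:
  fixes \<mu> :: "'a::euclidean_space measure"
  assumes "prob_space \<mu>" and [measurable_cong]: "sets \<mu> = sets borel"
    and h: "integrable lborel h" and a: "a > 0"
  shows "has_bochner_integral lborel (\<lambda>u. h u * gauss_smooth a \<mu> u)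
     (\<integral>x. (\<integral>u. h u * exp (- (a * (norm (x - u))\<^sup>2)) \<partial>lborel) \<partial>\<mu>)"
proof -
  interpret prob_space \<mu> by fact
  interpret P: pair_sigma_finite \<mu> "lborel :: 'a measure" by standard
  have [measurable]: "h \<in> borel_measurable borel" using h by auto
  have bd: "norm (h u * exp (- (a * (norm (x - u))\<^sup>2))) \<le> norm (h u)" for x u
    using a by (simp add: abs_mult mult_left_le)
  have int: "integrable lborel (\<lambda>u. h u * exp (- (a * (norm (x - u))\<^sup>2)))" for x
    by (rule Bochner_Integration.integrable_bound[OF h]) (use bd in auto)
  have "has_bochner_integral lborel (\<lambda>u. \<integral>x. h u * exp (- (a * (norm (x - u))\<^sup>2)) \<partial>\<mu>)
     (\<integral>x. (\<integral>u. h u * exp (- (a * (norm (x - u))\<^sup>2)) \<partial>lborel) \<partial>\<mu>)"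
  proof (rule P.has_bochner_integral_Fubini)
    show "integrable \<mu> (\<lambda>x. \<integral>u. norm (h u * exp (- (a * (norm (x - u))\<^sup>2))) \<partial>lborel)"
    proof (rule integrable_const_bound[where B="\<integral>u. norm (h u) \<partial>lborel"])
      show "AE x in \<mu>. norm (\<integral>u. norm (h u * exp (- (a * (norm (x - u))\<^sup>2))) \<partial>lborel) \<le> (\<integral>u. norm (h u) \<partial>lborel)"
        using int h bd by (intro AE_I2) (auto intro!: integral_mono)
    qed measurable
  qed (use int in \<open>auto simp: has_bochner_integral_iff\<close>)
  then show ?thesis by (simp add: gauss_smooth_def)
qed

section \<open>L2 estimates for two laws\<close>

context
  fixes \<mu> \<nu> :: "(real ^ 'd) measure"
  assumes prob: "prob_space \<mu>" "prob_space \<nu>"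
    and sets: "sets \<mu> = sets borel" "sets \<nu> = sets borel"
begin

text \<open>Expand both squares and apply Parseval to the pairs (mu, mu), (mu, nu) and (nu, nu). The
  Gaussian weight left on the frequency side is at most 1; dropping it is what makes the bound
  independent of a.\<close>

lemma integral_gauss_smooth_diff_le:
  assumes a: "a > 0"
    and int: "integrable lborel (\<lambda>z. (norm (char_vec \<mu> (\<lambda>x. x) z - char_vec \<nu> (\<lambda>x. x) z))\<^sup>2)"
  shows "integrable lborel (\<lambda>u. (gauss_smooth a \<mu> u - gauss_smooth a \<nu> u)\<^sup>2)" (is ?A)
    and "(2 * a) ^ CARD('d) * (\<integral>u. (gauss_smooth a \<mu> u - gauss_smooth a \<nu> u)\<^sup>2 \<partial>lborel)
         \<le> (\<integral>z. (norm (char_vec \<mu> (\<lambda>x. x) z - char_vec \<nu> (\<lambda>x. x) z))\<^sup>2 \<partial>lborel)" (is ?B)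
proof -
  note PP = Parseval_gauss_smooth[OF prob(1) prob(1) sets(1) sets(1) a]
    Parseval_gauss_smooth[OF prob(1) prob(2) sets(1) sets(2) a]
    Parseval_gauss_smooth[OF prob(2) prob(2) sets(2) sets(2) a]
  note KK = integral_gauss_smooth_mult[OF prob(1) prob(1) sets(1) sets(1) a]
    integral_gauss_smooth_mult[OF prob(1) prob(2) sets(1) sets(2) a]
    integral_gauss_smooth_mult[OF prob(2) prob(2) sets(2) sets(2) a]
  let ?p = "char_vec \<mu> (\<lambda>x. x)" and ?q = "char_vec \<nu> (\<lambda>x. x)"
  let ?g = "\<lambda>z::real^'d. exp (- ((norm z)\<^sup>2 / (2 * a)))"
  let ?K = "gauss_smooth a \<mu>" and ?L = "gauss_smooth a \<nu>"
  have sq: "(?K u - ?L u)\<^sup>2 = ?K u * ?K u - 2 * (?K u * ?L u) + ?L u * ?L u" for u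
    by (simp add: power2_eq_square algebra_simps)
  show ?A unfolding sq using KK by (auto simp: has_bochner_integral_iff)
  have I: "(\<integral>u. (?K u - ?L u)\<^sup>2 \<partial>lborel) =
      (\<integral>u. ?K u * ?K u \<partial>lborel) - 2 * (\<integral>u. ?K u * ?L u \<partial>lborel) + (\<integral>u. ?L u * ?L u \<partial>lborel)"
    unfolding sq using KK by (subst Bochner_Integration.integral_add) (auto simp: has_bochner_integral_iff)
  have nsq: "(norm (v - w))\<^sup>2 * r = Re (v * cnj v) * r - 2 * (Re (v * cnj w) * r) + Re (w * cnj w) * r"
    for v w :: complex and r :: real
    unfolding cmod_power2 by (simp add: power2_eq_square algebra_simps)
  have "has_bochner_integral lborel (\<lambda>z. (norm (?p z - ?q z))\<^sup>2 * ?g z)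
     ((2 * a) ^ CARD('d) * (\<integral>u. ?K u * ?K u \<partial>lborel) - 2 * ((2 * a) ^ CARD('d) * (\<integral>u. ?K u * ?L u \<partial>lborel))
        + (2 * a) ^ CARD('d) * (\<integral>u. ?L u * ?L u \<partial>lborel))"
    unfolding nsq
    by (intro has_bochner_integral_add has_bochner_integral_diff has_bochner_integral_mult_right PP)
  then have i: "integrable lborel (\<lambda>z. (norm (?p z - ?q z))\<^sup>2 * ?g z)"
    and "(2 * a) ^ CARD('d) * (\<integral>u. (?K u - ?L u)\<^sup>2 \<partial>lborel) = (\<integral>z. (norm (?p z - ?q z))\<^sup>2 * ?g z \<partial>lborel)"
    unfolding I by (simp_all add: has_bochner_integral_iff algebra_simps)
  note this(2)
  also have "(\<integral>z. (norm (?p z - ?q z))\<^sup>2 * ?g z \<partial>lborel) \<le> (\<integral>z. (norm (?p z - ?q z))\<^sup>2 \<partial>lborel)"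
    using i int a by (intro integral_mono) (auto intro!: mult_left_le)
  finally show ?B .
qed

lemma integral_diff_le_char_vec:
  assumes int: "integrable lborel (\<lambda>z. (norm (char_vec \<mu> (\<lambda>x. x) z - char_vec \<nu> (\<lambda>x. x) z))\<^sup>2)"
    and h: "continuous_on UNIV h" "integrable lborel h" and B: "\<And>x. \<bar>h x\<bar> \<le> 1" and c: "c > 0"
  shows "2 * ((\<integral>x. h x \<partial>\<mu>) - (\<integral>x. h x \<partial>\<nu>)) \<le> c * (\<integral>x. (h x)\<^sup>2 \<partial>lborel) +
     (\<integral>z. (norm (char_vec \<mu> (\<lambda>x. x) z - char_vec \<nu> (\<lambda>x. x) z))\<^sup>2 \<partial>lborel) / c"
    (is "_ \<le> ?R")
proof -
  let ?s = "\<lambda>n. real (Suc n)"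
  define a where "a n = (?s n)\<^sup>2" for n
  define k where "k n = sqrt (a n / pi) ^ CARD('d)" for n
  define D where "D = (\<integral>z. (norm (char_vec \<mu> (\<lambda>x. x) z - char_vec \<nu> (\<lambda>x. x) z))\<^sup>2 \<partial>lborel)"
  have a: "a n > 0" for n by (simp add: a_def)
  have k: "k n > 0" for n using a[of n] by (simp add: k_def)
  have D: "D \<ge> 0" by (simp add: D_def)
  have hm [measurable]: "h \<in> borel_measurable borel" using h by auto
  \<comment> \<open>\<open>H n\<close> is h convolved with the normalised kernel. Its integrals
    against the laws are integrals of h against the smoothed densities, where the L2 bound applies;
    the limit in n recovers h.\<close>
  define H where "H n x = k n * (\<integral>u. h u * exp (- (a n * (norm (x - u))\<^sup>2)) \<partial>lborel)" for n x
  have Hx: "(\<lambda>n. H n x) \<longlonglongrightarrow> h x" for x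
    using gauss_mollifier_tendsto[OF h(1) B, of x] by (simp add: H_def k_def a_def del: of_nat_Suc)
  have Hb: "\<bar>H n x\<bar> \<le> 1" for n x
  proof -
    have g: "has_bochner_integral lborel (\<lambda>u. exp (- (a n * (norm (x - u))\<^sup>2))) (sqrt (pi / a n) ^ CARD('d))"
      using gaussian_integral_shift[OF a[of n], of x] by (simp add: norm_minus_commute)
    have "\<bar>\<integral>u. h u * exp (- (a n * (norm (x - u))\<^sup>2)) \<partial>lborel\<bar> \<le> (\<integral>u. exp (- (a n * (norm (x - u))\<^sup>2)) \<partial>lborel)"
      using g B by (intro integral_abs_bound[THEN order_trans] integral_mono')
        (auto simp: has_bochner_integral_iff abs_mult mult_le_cancel_right1)
    also have "\<dots> = sqrt (pi / a n) ^ CARD('d)" using g by (simp add: has_bochner_integral_iff)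
    finally have "\<bar>H n x\<bar> \<le> k n * sqrt (pi / a n) ^ CARD('d)"
      using k[of n] by (simp add: H_def abs_mult)
    also have "\<dots> = 1"
      using a[of n] by (simp add: k_def real_sqrt_divide power_divide)
    finally show ?thesis .
  qed
  have lim: "(\<lambda>n. \<integral>x. H n x \<partial>\<rho>) \<longlonglongrightarrow> (\<integral>x. h x \<partial>\<rho>)"
    if "prob_space \<rho>" and [measurable_cong]: "sets \<rho> = sets borel" for \<rho> :: "(real ^ 'd) measure"
  proof -
    interpret prob_space \<rho> by fact
    show ?thesis
      using Hx Hb by (intro integral_dominated_convergence[where w="\<lambda>_. 1"]) (auto simp: H_def[abs_def])
  qed
  have main: "2 * ((\<integral>x. H n x \<partial>\<mu>) - (\<integral>x. H n x \<partial>\<nu>)) \<le> ?R" for n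
  proof -
    let ?K = "gauss_smooth (a n) \<mu>" and ?L = "gauss_smooth (a n) \<nu>"
    note g = integral_gauss_smooth[OF prob(1) sets(1) h(2) a[of n]]
      integral_gauss_smooth[OF prob(2) sets(2) h(2) a[of n]]
    have h2: "integrable lborel (\<lambda>x. (h x)\<^sup>2)"
    proof (rule Bochner_Integration.integrable_bound[OF h(2)])
      have "norm ((h x)\<^sup>2) \<le> norm (h x)" for x
        unfolding power2_eq_square real_norm_def abs_mult by (rule mult_left_le[OF B abs_ge_zero])
      then show "AE x in lborel. norm ((h x)\<^sup>2) \<le> norm (h x)" by simp
    qed measurable
    have "2 * ((\<integral>x. H n x \<partial>\<mu>) - (\<integral>x. H n x \<partial>\<nu>)) = (\<integral>u. 2 * (k n * (h u * ?K u - h u * ?L u)) \<partial>lborel)"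
      using has_bochner_integral_mult_right[OF has_bochner_integral_mult_right[OF
          has_bochner_integral_diff[OF g]], of 2 "k n"]
      by (simp add: H_def[abs_def] has_bochner_integral_iff right_diff_distrib)
    also have "\<dots> \<le> (\<integral>u. c * (h u)\<^sup>2 + (k n)\<^sup>2 / c * (?K u - ?L u)\<^sup>2 \<partial>lborel)"
    proof (intro integral_mono)
      show "2 * (k n * (h u * ?K u - h u * ?L u)) \<le> c * (h u)\<^sup>2 + (k n)\<^sup>2 / c * (?K u - ?L u)\<^sup>2" for u
      proof -
        \<comment> \<open>Completing the square gives the pointwise form of Cauchy-Schwarz with
          parameter c.\<close>
        have "0 \<le> (c * h u - k n * (?K u - ?L u))\<^sup>2 / c" using c by simp
        also have "\<dots> = c * (h u)\<^sup>2 + (k n)\<^sup>2 / c * (?K u - ?L u)\<^sup>2 - 2 * (k n * (h u * ?K u - h u * ?L u))"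
          using c by (simp add: power2_eq_square field_simps)
        finally show ?thesis by simp
      qed
    qed (use g h2 integral_gauss_smooth_diff_le(1)[OF a int] in \<open>auto simp: has_bochner_integral_iff\<close>)
    also have "\<dots> = c * (\<integral>x. (h x)\<^sup>2 \<partial>lborel) + (k n)\<^sup>2 / c * (\<integral>u. (?K u - ?L u)\<^sup>2 \<partial>lborel)"
      using h2 integral_gauss_smooth_diff_le(1)[OF a int] by simp
    also have "(k n)\<^sup>2 / c * (\<integral>u. (?K u - ?L u)\<^sup>2 \<partial>lborel) \<le> D / c"
    proof -
      \<comment> \<open>Here the Plancherel constant (2 pi)^(-d) is replaced by 1.\<close>
      have "(k n)\<^sup>2 = (a n / pi) ^ CARD('d)"
        using a[of n] by (simp add: k_def power_mult_distrib[symmetric] power2_eq_square)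
      also have "\<dots> \<le> (2 * a n) ^ CARD('d)"
      proof (rule power_mono)
        have "a n / pi \<le> a n / 1" using a[of n] pi_gt3 by (intro divide_left_mono) auto
        then show "a n / pi \<le> 2 * a n" using a[of n] by simp
      qed (use a[of n] in simp)
      finally have "(k n)\<^sup>2 * (\<integral>u. (?K u - ?L u)\<^sup>2 \<partial>lborel) \<le> (2 * a n) ^ CARD('d) * (\<integral>u. (?K u - ?L u)\<^sup>2 \<partial>lborel)"
        by (rule mult_right_mono) simp
      also have "\<dots> \<le> D" unfolding D_def by (rule integral_gauss_smooth_diff_le(2)[OF a int])
      finally show ?thesis using c by (simp add: divide_right_mono)
    qed
    finally show ?thesis by (simp add: D_def)
  qed
  have "(\<lambda>n. 2 * ((\<integral>x. H n x \<partial>\<mu>) - (\<integral>x. H n x \<partial>\<nu>))) \<longlonglongrightarrow> 2 * ((\<integral>x. h x \<partial>\<mu>) - (\<integral>x. h x \<partial>\<nu>))"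
    by (intro tendsto_intros lim prob sets)
  then show ?thesis
    using main by (intro LIMSEQ_le_const2[of _ _ ?R]) auto
qed

end

subsection \<open>Bounded Borel sets\<close>

text \<open>The set C does not depend on n, so its indicator is one integrable majorant for the
  whole sequence under Lebesgue measure. It is the closed 1-neighbourhood of K.\<close>

lemma compact_cutoff:
  fixes K :: "'a::euclidean_space set"
  assumes K: "compact K"
  obtains h :: "nat \<Rightarrow> 'a \<Rightarrow> real" and C where "\<And>n. continuous_on UNIV (h n)" "\<And>n x. 0 \<le> h n x"
    "compact C" "\<And>n x. h n x \<le> indicator C x" "\<And>x. (\<lambda>n. h n x) \<longlonglongrightarrow> indicator K x"
proof (cases "K = {}")
  \<comment> \<open>By convention \<open>infdist x {}\<close> is 0, so the cutoffs of the other case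
    would be constantly 1 here.\<close>
  case True
  show ?thesis
    by (rule that[of "\<lambda>_ _. 0" "{}"]) (auto simp: True)
next
  case False
  \<comment> \<open>With \<open>Suc n\<close> the slope is at least 1, so already \<open>h 0\<close>
    vanishes off the 1-neighbourhood.\<close>
  define h where "h n x = max 0 (1 - real (Suc n) * infdist x K)" for n x
  have lim: "(\<lambda>n. h n x) \<longlonglongrightarrow> indicator K x" for x
  proof (cases "x \<in> K")
    case True
    then show ?thesis by (simp add: h_def)
  next
    case nK: False
    have d: "infdist x K > 0"
      using infdist_pos_not_in_closed[OF compact_imp_closed[OF K] False nK] .
    have "filterlim (\<lambda>n. infdist x K * real (Suc n)) at_top sequentially"
      by (intro filterlim_tendsto_pos_mult_at_top[OF tendsto_const d]
          filterlim_compose[OF filterlim_real_sequentially filterlim_Suc])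
    then have "eventually (\<lambda>n. 1 \<le> infdist x K * real (Suc n)) sequentially"
      unfolding filterlim_at_top by blast
    then have "eventually (\<lambda>n. h n x = indicator K x) sequentially"
      by eventually_elim (use nK in \<open>simp add: h_def mult.commute del: of_nat_Suc\<close>)
    then show ?thesis by (rule tendsto_eventually)
  qed
  show ?thesis
  proof (rule that[of h "{x. infdist x K \<le> 1}", OF _ _ _ _ lim])
    show "continuous_on UNIV (h n)" for n
      unfolding h_def by (intro continuous_intros)
    show "compact {x. infdist x K \<le> 1}"
      using False K by (rule compact_infdist_le) simp
    show "h n x \<le> indicator {x. infdist x K \<le> 1} x" for n x
    proof (cases "infdist x K \<le> 1")
      case True
      then show ?thesis using infdist_nonneg[of x K] by (simp add: h_def)
    next
      case False
      then have "1 * 1 \<le> real (Suc n) * infdist x K"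
        by (intro mult_mono) auto
      then show ?thesis using False by (simp add: h_def)
    qed
  qed (simp add: h_def)
qed

lemma inner_regular_measure:
  fixes M :: "'a::{second_countable_topology, complete_space} measure"
  assumes "finite_measure M" and "sets M = sets borel" and "A \<in> sets borel" and e: "e > 0"
  obtains K where "compact K" "K \<subseteq> A" "measure M A - e < measure M K"
proof (rule ccontr)
  interpret finite_measure M by fact
  assume "\<not> thesis"
  with that have *: "measure M K \<le> measure M A - e" if "compact K" "K \<subseteq> A" for K
    using that by (meson not_le)
  have "emeasure M A = (SUP K \<in> {K. K \<subseteq> A \<and> compact K}. emeasure M K)"
    using assms by (intro inner_regular) auto
  also have "\<dots> \<le> ennreal (measure M A - e)"
    using * by (intro SUP_least) (auto simp: emeasure_eq_measure intro!: ennreal_leI)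
  \<comment> \<open>The empty set, as a compact subset, shows measure M A - e >= 0, so
    \<open>ennreal\<close> does not truncate it.\<close>
  finally have "measure M A \<le> measure M A - e"
    using *[of "{}"] by (simp add: emeasure_eq_measure)
  with e show False by simp
qed

text \<open>Approximate A from inside by a compact K that nearly exhausts its mu-mass. Going back
  from K to A increases both the nu-mass, which is subtracted, and the volume on the right.
  Boundedness keeps the volume of A finite; \<open>measure\<close> would read an infinite one as
  0.\<close>

lemma measure_diff_le_char_vec:
  fixes \<mu> \<nu> :: "(real ^ 'd) measure"
  assumes prob: "prob_space \<mu>" "prob_space \<nu>"
    and sets: "sets \<mu> = sets borel" "sets \<nu> = sets borel"
    and int: "integrable lborel (\<lambda>z. (norm (char_vec \<mu> (\<lambda>x. x) z - char_vec \<nu> (\<lambda>x. x) z))\<^sup>2)"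
    and A: "A \<in> sets borel" "bounded A" and c: "c > 0"
  shows "2 * (measure \<mu> A - measure \<nu> A) \<le> c * measure lborel A +
     (\<integral>z. (norm (char_vec \<mu> (\<lambda>x. x) z - char_vec \<nu> (\<lambda>x. x) z))\<^sup>2 \<partial>lborel) / c"
    (is "_ \<le> _ + ?D / c")
proof -
  interpret mu: prob_space \<mu> by (rule prob)
  interpret nu: prob_space \<nu> by (rule prob)
  note sets [measurable_cong]
  have comp: "2 * (measure \<mu> K - measure \<nu> K) \<le> c * measure lborel K + ?D / c" if K: "compact K" for K
  proof -
    obtain h :: "nat \<Rightarrow> real^'d \<Rightarrow> real" and C where h: "\<And>n. continuous_on UNIV (h n)" "\<And>n x. 0 \<le> h n x"
      and C: "compact C" and hC: "\<And>n x. h n x \<le> indicator C x" and lim: "\<And>x. (\<lambda>n. h n x) \<longlonglongrightarrow> indicator K x"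
      using compact_cutoff[OF K] by blast
    have [measurable]: "h n \<in> borel_measurable borel" for n
      using h(1) by (rule borel_measurable_continuous_onI)
    have KC [measurable]: "K \<in> sets borel" "C \<in> sets borel"
      using K C by (auto intro: borel_compact)
    have h1: "h n x \<le> 1" for n x
      by (rule order_trans[OF hC indicator_le_1])
    have iC: "integrable lborel (indicator C :: real^'d \<Rightarrow> real)"
      using emeasure_compact_finite[OF C] by simp
    have hi: "integrable lborel (h n)" for n
      by (rule Bochner_Integration.integrable_bound[OF iC]) (use h hC in auto)
    have "(\<lambda>n. \<integral>x. h n x \<partial>\<mu>) \<longlonglongrightarrow> (\<integral>x. indicator K x \<partial>\<mu>)"
      using h h1 lim by (intro integral_dominated_convergence[where w="\<lambda>_. 1"]) auto
    moreover have "(\<lambda>n. \<integral>x. h n x \<partial>\<nu>) \<longlonglongrightarrow> (\<integral>x. indicator K x \<partial>\<nu>)"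
      using h h1 lim by (intro integral_dominated_convergence[where w="\<lambda>_. 1"]) auto
    moreover have "(\<lambda>n. \<integral>x. (h n x)\<^sup>2 \<partial>lborel) \<longlonglongrightarrow> (\<integral>x. (indicator K x)\<^sup>2 \<partial>lborel)"
    \<comment> \<open>The constant majorant used for the two laws is not Lebesgue integrable; the
      indicator of C takes its place.\<close>
    proof (rule integral_dominated_convergence[OF _ _ iC])
      show "AE x in lborel. (\<lambda>n. (h n x)\<^sup>2) \<longlonglongrightarrow> (indicator K x)\<^sup>2"
        by (intro AE_I2 tendsto_intros lim)
      have "(h n x)\<^sup>2 \<le> indicator C x" for n x
      proof -
        have "(h n x)\<^sup>2 \<le> h n x" using h(2) h1 by (simp add: power2_eq_square mult_left_le)
        with hC[of n x] show ?thesis by simp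
      qed
      then show "AE x in lborel. norm ((h n x)\<^sup>2) \<le> indicator C x" for n by simp
    qed simp_all
    ultimately have L: "(\<lambda>n. c * (\<integral>x. (h n x)\<^sup>2 \<partial>lborel) + ?D / c) \<longlonglongrightarrow> c * (\<integral>x. (indicator K x)\<^sup>2 \<partial>lborel) + ?D / c"
      and R: "(\<lambda>n. 2 * ((\<integral>x. h n x \<partial>\<mu>) - (\<integral>x. h n x \<partial>\<nu>))) \<longlonglongrightarrow> 2 * ((\<integral>x. indicator K x \<partial>\<mu>) - (\<integral>x. indicator K x \<partial>\<nu>))"
      by (auto intro!: tendsto_intros)
    have "2 * ((\<integral>x. indicator K x \<partial>\<mu>) - (\<integral>x. indicator K x \<partial>\<nu>)) \<le> c * (\<integral>x. (indicator K x)\<^sup>2 \<partial>lborel) + ?D / c"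
      using integral_diff_le_char_vec[OF prob sets int h(1) hi _ c] h(2) h1
      by (intro LIMSEQ_le[OF R L]) auto
    moreover have "(indicator K x :: real)\<^sup>2 = indicator K x" for x by (simp add: indicator_def)
    ultimately show ?thesis by (simp add: sets)
  qed
  show ?thesis
  proof (rule field_le_epsilon)
    fix e :: real assume e: "e > 0"
    obtain K where K: "compact K" "K \<subseteq> A" "measure \<mu> A - e / 2 < measure \<mu> K"
      using inner_regular_measure[OF mu.finite_measure_axioms sets(1) A(1), of "e / 2"] e by auto
    have "measure \<nu> K \<le> measure \<nu> A"
      using K A by (intro nu.finite_measure_mono) (auto simp: sets)
    moreover have "measure lborel K \<le> measure lborel A"
      using K A borel_compact[OF K(1)] emeasure_bounded_finite[OF A(2)] by (intro measure_mono_fmeasurable) (auto simp: fmeasurable_def)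
    then have "c * measure lborel K \<le> c * measure lborel A" using c by simp
    ultimately show "2 * (measure \<mu> A - measure \<nu> A) \<le> c * measure lborel A + ?D / c + e"
      using comp[OF K(1)] K(3) by argo
  qed
qed

subsection \<open>Maximal couplings\<close>

text \<open>Serves twice: to form a measure dominating both laws, and to glue the diagonal and
  off-diagonal parts of a coupling.\<close>

definition add_measure :: "'a measure \<Rightarrow> 'a measure \<Rightarrow> 'a measure" where
  "add_measure M N = measure_of (space M) (sets M) (\<lambda>A. emeasure M A + emeasure N A)"

lemma space_add_measure [simp]: "space (add_measure M N) = space M"
  and sets_add_measure [simp, measurable_cong]: "sets (add_measure M N) = sets M"
  by (simp_all add: add_measure_def sets.space_closed sets.sigma_sets_eq)

lemma emeasure_add_measure:
  assumes "sets N = sets M" "A \<in> sets M"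
  shows "emeasure (add_measure M N) A = emeasure M A + emeasure N A"
  unfolding add_measure_def
proof (rule emeasure_measure_of_sigma)
  show "countably_additive (sets M) (\<lambda>A. emeasure M A + emeasure N A)"
    unfolding countably_additive_def
    by (auto simp: suminf_add[symmetric] suminf_emeasure assms)
qed (use assms in \<open>auto simp: positive_def sets.sigma_algebra_axioms\<close>)

text \<open>Subtraction on \<open>ennreal\<close> is truncated, so a - b is the positive part: the
  excess of a over the common part.\<close>

lemma ennreal_min_plus_diff: "min a b + (a - b) = (a :: ennreal)"
  by (cases "a \<le> b") (auto simp: min_def diff_eq_0_iff_ennreal add_diff_inverse_ennreal not_less top_unique)

text \<open>
  Both measures have densities \<open>f\<close>, \<open>g\<close> with respect to their sum. The common part \<open>min f g\<close> is put on
  the diagonal, and the two excess parts, which have the same mass, are coupled independently.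
\<close>

lemma maximal_coupling:
  assumes prob: "prob_space N1" "prob_space N2" and sets: "sets N2 = sets N1"
  obtains P A where "P \<in> couplings N1 N2" "A \<in> sets N1"
    "measure P {p \<in> space P. fst p \<noteq> snd p} \<le> measure N2 A - measure N1 A"
proof -
  interpret N1: prob_space N1 by (rule prob)
  interpret N2: prob_space N2 by (rule prob)
  have space: "space N2 = space N1" using sets by (rule sets_eq_imp_space_eq)
  define S where "S = add_measure N1 N2"
  have sS [measurable_cong, simp]: "sets S = sets N1" and spS [simp]: "space S = space N1"
    by (simp_all add: S_def)
  note sets [measurable_cong, simp] space [simp]
  have S: "emeasure S A = emeasure N1 A + emeasure N2 A" if "A \<in> sets N1" for A
    using that by (simp add: S_def emeasure_add_measure)
  interpret S: finite_measure S
    by (rule finite_measureI) (use S[of "space N1"] N1.emeasure_space_1 N2.emeasure_space_1 in simp)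
  have "absolutely_continuous S N1" "absolutely_continuous S N2"
    by (auto simp: absolutely_continuous_def null_sets_def S)
  then obtain f g where fg [measurable]: "f \<in> borel_measurable S" "g \<in> borel_measurable S"
    and f: "density S f = N1" and g: "density S g = N2"
    using S.Radon_Nikodym[of N1] S.Radon_Nikodym[of N2] by auto
  define m where "m = density S (\<lambda>x. min (f x) (g x))"
  define e1 where "e1 = density S (\<lambda>x. f x - g x)"
  define e2 where "e2 = density S (\<lambda>x. g x - f x)"
  have [measurable_cong, simp]: "sets m = sets N1" "sets e1 = sets N1" "sets e2 = sets N1"
    and [simp]: "space m = space N1" "space e1 = space N1" "space e2 = space N1"
    by (simp_all add: m_def e1_def e2_def)
  have N1_eq: "emeasure N1 E = emeasure m E + emeasure e1 E" if [measurable]: "E \<in> sets N1" for E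
  proof -
    have "emeasure N1 E = (\<integral>\<^sup>+x. f x * indicator E x \<partial>S)"
      unfolding f[symmetric] by (rule emeasure_density) (simp_all add: that)
    also have "\<dots> = (\<integral>\<^sup>+x. min (f x) (g x) * indicator E x + (f x - g x) * indicator E x \<partial>S)"
      by (simp add: distrib_right[symmetric] ennreal_min_plus_diff)
    finally show ?thesis
      by (simp add: m_def e1_def emeasure_density nn_integral_add that)
  qed
  have N2_eq: "emeasure N2 E = emeasure m E + emeasure e2 E" if [measurable]: "E \<in> sets N1" for E
  proof -
    have "emeasure N2 E = (\<integral>\<^sup>+x. g x * indicator E x \<partial>S)"
      unfolding g[symmetric] by (rule emeasure_density) (simp_all add: that)
    also have "\<dots> = (\<integral>\<^sup>+x. min (f x) (g x) * indicator E x + (g x - f x) * indicator E x \<partial>S)"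
      by (simp add: distrib_right[symmetric] ennreal_min_plus_diff min.commute[of "f _"])
    finally show ?thesis
      by (simp add: m_def e2_def emeasure_density nn_integral_add that)
  qed
  define p where "p = emeasure e1 (space N1)"
  \<comment> \<open>Both laws have mass 1 and share m, so the two excess parts have equal mass
    p.\<close>
  have tot: "emeasure m (space N1) + p = 1" "emeasure m (space N1) + emeasure e2 (space N1) = 1"
    using N1_eq[of "space N1"] N2_eq[of "space N1"] N1.emeasure_space_1 N2.emeasure_space_1
    by (simp_all add: p_def)
  then have m_fin: "emeasure m (space N1) \<noteq> \<top>" and p_fin: "p \<noteq> \<top>" by auto
  have p2: "emeasure e2 (space N1) = p"
  proof -
    have "emeasure m (space N1) + emeasure e2 (space N1) = emeasure m (space N1) + p"
      by (simp only: tot)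
    then show ?thesis using m_fin unfolding ennreal_add_left_cancel by simp
  qed
  interpret e1: finite_measure e1 by (rule finite_measureI) (use p_fin in \<open>simp add: p_def\<close>)
  interpret e2: finite_measure e2 by (rule finite_measureI) (use p_fin p2 in simp)
  have le_p: "emeasure e1 E \<le> p" "emeasure e2 E \<le> p" for E
    using emeasure_space[of e1 E] emeasure_space[of e2 E] p2 by (simp_all add: p_def)
  \<comment> \<open>For p = 0 the laws coincide, \<open>inverse p\<close> is infinite, and infinity
    times 0 is 0; the coupling below therefore needs no separate case.\<close>
  have cancel: "inverse p * (a * p) = a" if "a \<le> p" for a
  proof (cases "p = 0")
    case False
    then have "p * inverse p = 1"
      using ennreal_divide_self[of p] p_fin by (simp add: divide_ennreal_def less_top)
    moreover have "inverse p * (a * p) = a * (p * inverse p)" by (simp only: ac_simps)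
    ultimately show ?thesis by simp
  qed (use that in simp)
  define D where "D = distr m (N1 \<Otimes>\<^sub>M N2) (\<lambda>x. (x, x))"
  \<comment> \<open>The product of the excess parts has mass p^2 and marginals p e1 and p e2;
    dividing by p restores e1 and e2.\<close>
  define R where "R = scale_measure (inverse p) (e1 \<Otimes>\<^sub>M e2)"
  define P where "P = add_measure D R"
  have sets_R: "sets R = sets (N1 \<Otimes>\<^sub>M N2)"
    by (simp add: R_def cong: sets_pair_measure_cong)
  have sP [measurable_cong]: "sets P = sets (N1 \<Otimes>\<^sub>M N2)" by (simp add: P_def D_def)
  have spP: "space P = space N1 \<times> space N1"
    using sets_eq_imp_space_eq[OF sP] by (simp add: space_pair_measure)
  have diag: "(\<lambda>x. (x, x)) \<in> m \<rightarrow>\<^sub>M N1 \<Otimes>\<^sub>M N2" by measurable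
  have P: "emeasure P E = emeasure m ((\<lambda>x. (x, x)) -` E \<inter> space N1) + inverse p * emeasure (e1 \<Otimes>\<^sub>M e2) E"
    if "E \<in> sets (N1 \<Otimes>\<^sub>M N2)" for E
    using that emeasure_distr[OF diag that] sets_R
    by (simp add: P_def emeasure_add_measure D_def) (simp add: R_def)
  have fstP: "distr P N1 fst = N1"
  proof (rule measure_eqI)
    fix E assume "E \<in> sets (distr P N1 fst)"
    then have E: "E \<in> sets N1" by simp
    have "emeasure (distr P N1 fst) E = emeasure P (E \<times> space N1)"
      using E sets.sets_into_space[OF E]
      by (subst emeasure_distr) (auto simp: spP intro!: arg_cong2[where f=emeasure])
    also have "\<dots> = emeasure m E + inverse p * (emeasure e1 E * p)"
      using E sets.sets_into_space[OF E] pair_measureI[of E N1 "space N1" N2]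
      by (subst P) (auto simp: e2.emeasure_pair_measure_Times p2 intro!: arg_cong2[where f=emeasure] arg_cong2[where f="(+)"])
    also have "\<dots> = emeasure N1 E"
      using E by (simp add: cancel le_p N1_eq)
    finally show "emeasure (distr P N1 fst) E = emeasure N1 E" .
  qed simp
  have sndP: "distr P N2 snd = N2"
  proof (rule measure_eqI)
    fix E assume "E \<in> sets (distr P N2 snd)"
    then have E: "E \<in> sets N1" by simp
    have "emeasure (distr P N2 snd) E = emeasure P (space N1 \<times> E)"
      using E sets.sets_into_space[OF E]
      by (subst emeasure_distr) (auto simp: spP intro!: arg_cong2[where f=emeasure])
    also have "\<dots> = emeasure m E + inverse p * (emeasure e2 E * p)"
      using E sets.sets_into_space[OF E] pair_measureI[of "space N1" N1 E N2]
      by (subst P) (auto simp: e2.emeasure_pair_measure_Times p_def mult.commute intro!: arg_cong2[where f=emeasure] arg_cong2[where f="(+)"])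
    also have "\<dots> = emeasure N2 E"
      using E by (simp add: cancel le_p N2_eq)
    finally show "emeasure (distr P N2 snd) E = emeasure N2 E" .
  qed simp
  interpret P: prob_space P
  proof (rule prob_spaceI)
    have "emeasure P (space P) = emeasure (distr P N1 fst) (space N1)"
      by (subst emeasure_distr) (auto simp: spP intro!: arg_cong2[where f=emeasure])
    then show "emeasure P (space P) = 1" by (simp add: fstP N1.emeasure_space_1)
  qed
  \<comment> \<open>On A the common part is N1, and the whole excess e2 lives on A, so N2(A) - N1(A)
    = p.\<close>
  define A where "A = {x \<in> space N1. f x \<le> g x}"
  have "{x \<in> space S. f x \<le> g x} \<in> sets S" by measurable
  then have A [measurable]: "A \<in> sets N1" by (simp add: A_def)
  have "emeasure N2 A = emeasure N1 A + p"
  proof -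
    have "emeasure m A = emeasure N1 A"
      unfolding m_def f[symmetric] using A
      by (simp add: emeasure_density) (auto simp: A_def indicator_def intro!: nn_integral_cong)
    moreover have "emeasure e2 A = emeasure e2 (space N1)"
      unfolding e2_def using A
      by (simp add: emeasure_density) (auto simp: A_def indicator_def diff_eq_0_iff_ennreal not_le less_top[symmetric] intro!: nn_integral_cong intro: less_imp_le less_le_trans)
    ultimately show ?thesis using N2_eq[OF A] p2 by simp
  qed
  then have pA: "p = ennreal (measure N2 A - measure N1 A)"
    by (simp add: N1.emeasure_eq_measure N2.emeasure_eq_measure ennreal_minus[symmetric])
  moreover have "measure N1 A \<le> measure N2 A"
    using \<open>emeasure N2 A = _\<close>
    by (simp add: N1.emeasure_eq_measure N2.emeasure_eq_measure flip: ennreal_le_iff)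
  moreover have "emeasure P {p \<in> space P. fst p \<noteq> snd p} \<le> p"
  \<comment> \<open>Over a general sigma-algebra the off-diagonal set may fail to be measurable;
    \<open>emeasure\<close> then gives it the value 0.\<close>
  proof (cases "{p \<in> space P. fst p \<noteq> snd p} \<in> sets P")
    case True
    have "emeasure P {p \<in> space P. fst p \<noteq> snd p} = inverse p * emeasure (e1 \<Otimes>\<^sub>M e2) {p \<in> space P. fst p \<noteq> snd p}"
      using True by (subst P) (auto simp: sP)
    also have "\<dots> \<le> inverse p * emeasure (e1 \<Otimes>\<^sub>M e2) (space N1 \<times> space N1)"
      by (intro mult_left_mono emeasure_mono) (auto simp: spP)
    also have "\<dots> = p"
      using cancel[of p] by (simp add: e2.emeasure_pair_measure_Times p2 p_def)
    finally show ?thesis .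
  qed (simp add: emeasure_notin_sets)
  ultimately have "measure P {p \<in> space P. fst p \<noteq> snd p} \<le> measure N2 A - measure N1 A"
    by (simp add: P.emeasure_eq_measure)
  moreover have "P \<in> couplings N1 N2"
    unfolding couplings_def using P.prob_space_axioms sP fstP sndP by simp
  ultimately show thesis using that A by blast
qed

lemma tv_dist_le_measure_diff:
  assumes "prob_space N1" "prob_space N2" "sets N2 = sets N1"
  obtains A where "A \<in> sets N1" "0 \<le> tv_dist N1 N2" "tv_dist N1 N2 \<le> measure N2 A - measure N1 A"
proof -
  obtain P A where P: "P \<in> couplings N1 N2" and A: "A \<in> sets N1"
    and le: "measure P {p \<in> space P. fst p \<noteq> snd p} \<le> measure N2 A - measure N1 A"
    using maximal_coupling[OF assms] .
  have "tv_dist N1 N2 \<le> measure P {p \<in> space P. fst p \<noteq> snd p}"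
    unfolding tv_dist_def by (rule cINF_lower[OF _ P]) (auto intro!: bdd_belowI[of _ 0])
  \<comment> \<open>The coupling P makes the set of couplings nonempty, so the real infimum is
    meaningful.\<close>
  moreover have "0 \<le> tv_dist N1 N2"
    unfolding tv_dist_def using P by (intro cINF_greatest) auto
  ultimately show thesis using that A le by fastforce
qed

subsection \<open>Convergence of the characteristic functions\<close>

lemma char_vec_distr:
  assumes "X \<in> borel_measurable M"
  shows "char_vec (distr M borel X) (\<lambda>x. x) = char_vec M X"
  unfolding char_vec_def using assms by (intro ext integral_distr) auto

text \<open>Convergence in distribution is tested on real functions; this reduces characteristic
  functions to the tests cos and sin.\<close>

lemma char_vec_Re_Im:
  assumes "prob_space M" "X \<in> borel_measurable M"
  shows "char_vec M X z = Complex (\<integral>w. cos (z \<bullet> X w) \<partial>M) (\<integral>w. sin (z \<bullet> X w) \<partial>M)"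
proof -
  interpret prob_space M by fact
  have [measurable]: "X \<in> borel_measurable M" by fact
  have int: "integrable M (\<lambda>w. iexp (z \<bullet> X w))"
    by (rule integrable_const_bound[where B=1]) auto
  show ?thesis
    using integral_Re[OF int] integral_Im[OF int]
    by (simp add: char_vec_def complex_eq_iff Re_exp Im_exp)
qed

lemma norm_char_vec_le:
  assumes "prob_space M"
  shows "norm (char_vec M X z) \<le> 1"
proof -
  interpret prob_space M by fact
  have "norm (char_vec M X z) \<le> (\<integral>w. norm (iexp (z \<bullet> X w)) \<partial>M)"
    unfolding char_vec_def by (rule integral_norm_bound)
  also have "\<dots> = 1" by (simp add: prob_space)
  finally show ?thesis .
qed

lemma conv_in_distr_imp_char_vec_tendsto:
  assumes M: "prob_space M" and Xs: "eventually (\<lambda>i. Xs i \<in> borel_measurable M) F"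
    and X: "X \<in> borel_measurable M" and conv: "conv_in_distr M Xs X F"
  shows "((\<lambda>i. char_vec M (Xs i) z) \<longlongrightarrow> char_vec M X z) F"
proof -
  have "((\<lambda>i. \<integral>w. cos (z \<bullet> Xs i w) \<partial>M) \<longlongrightarrow> (\<integral>w. cos (z \<bullet> X w) \<partial>M)) F"
    by (rule conv[unfolded conv_in_distr_def, rule_format, of "\<lambda>x. cos (z \<bullet> x)"])
       (auto intro!: continuous_intros boundedI[where B=1])
  moreover have "((\<lambda>i. \<integral>w. sin (z \<bullet> Xs i w) \<partial>M) \<longlongrightarrow> (\<integral>w. sin (z \<bullet> X w) \<partial>M)) F"
    by (rule conv[unfolded conv_in_distr_def, rule_format, of "\<lambda>x. sin (z \<bullet> x)"])
       (auto intro!: continuous_intros boundedI[where B=1])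
  ultimately have "((\<lambda>i. Complex (\<integral>w. cos (z \<bullet> Xs i w) \<partial>M) (\<integral>w. sin (z \<bullet> Xs i w) \<partial>M)) \<longlongrightarrow> char_vec M X z) F"
    unfolding char_vec_Re_Im[OF M X] by (rule tendsto_Complex)
  moreover have "eventually (\<lambda>i. Complex (\<integral>w. cos (z \<bullet> Xs i w) \<partial>M) (\<integral>w. sin (z \<bullet> Xs i w) \<partial>M) = char_vec M (Xs i) z) F"
    using Xs by eventually_elim (simp add: char_vec_Re_Im[OF M])
  ultimately show ?thesis by (rule Lim_transform_eventually)
qed

lemma norm_diff_sq_le: "(norm (a - b))\<^sup>2 \<le> 2 * (norm a)\<^sup>2 + 2 * (norm (b :: 'a::real_normed_vector))\<^sup>2"
proof -
  have "(norm (a - b))\<^sup>2 \<le> (norm a + norm b)\<^sup>2"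
    by (intro power_mono norm_triangle_ineq4) simp
  also have "\<dots> \<le> 2 * (norm a)\<^sup>2 + 2 * (norm b)\<^sup>2"
    using sum_squares_bound[of "norm a" "norm b"] by (simp add: power2_sum)
  finally show ?thesis .
qed

lemma square_integrable_diff:
  assumes "square_integrable f" "square_integrable g"
  shows "integrable lborel (\<lambda>z. (norm (f z - g z))\<^sup>2)"
proof (rule Bochner_Integration.integrable_bound)
  show "integrable lborel (\<lambda>z. 2 * (norm (f z))\<^sup>2 + 2 * (norm (g z))\<^sup>2)"
    using assms by (auto simp: square_integrable_def)
  have [measurable]: "f \<in> borel_measurable borel" "g \<in> borel_measurable borel"
    using assms by (simp_all add: square_integrable_def)
  show "(\<lambda>z. (norm (f z - g z))\<^sup>2) \<in> borel_measurable lborel"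
    by measurable
  have "norm ((norm (f z - g z))\<^sup>2) \<le> norm (2 * (norm (f z))\<^sup>2 + 2 * (norm (g z))\<^sup>2)" for z
    using norm_diff_sq_le[of "f z" "g z"] by simp
  then show "AE z in lborel. norm ((norm (f z - g z))\<^sup>2) \<le> norm (2 * (norm (f z))\<^sup>2 + 2 * (norm (g z))\<^sup>2)"
    by simp
qed

text \<open>Split at |z| = l. Inside the ball, pointwise convergence and boundedness by 1 allow
  dominated convergence. Outside, |p - q|^2 <= 2 |p|^2 + 2 |q|^2, where the first tail is small
  since |p|^2 is integrable and the second by the hypothesis on tails.\<close>

lemma L2_tendsto_char_vec:
  fixes M :: "'w measure"
    and Xs :: "real \<Rightarrow> 'w \<Rightarrow> real ^ 'd"
    and X :: "'w \<Rightarrow> real ^ 'd"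
  assumes M: "prob_space M"
    and Xs: "\<And>\<epsilon>. \<epsilon> > 0 \<Longrightarrow> Xs \<epsilon> \<in> borel_measurable M"
    and X: "X \<in> borel_measurable M"
    and conv: "conv_in_distr M Xs X (at_right 0)"
    and sq: "square_integrable (char_vec M X)"
    and sqs: "\<And>\<epsilon>. \<epsilon> > 0 \<Longrightarrow> square_integrable (char_vec M (Xs \<epsilon>))"
    and tail: "Limsup at_top (\<lambda>l::real. Limsup (at_right 0) (\<lambda>\<epsilon>.
           \<integral>\<^sup>+z\<in>{z. norm z \<ge> l}. ennreal ((norm (char_vec M (Xs \<epsilon>) z))\<^sup>2) \<partial>lborel)) = 0"
  shows "((\<lambda>\<epsilon>. \<integral>z. (norm (char_vec M X z - char_vec M (Xs \<epsilon>) z))\<^sup>2 \<partial>lborel) \<longlongrightarrow> 0) (at_right 0)"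
proof -
  define p where "p = char_vec M X"
  define q where "q \<epsilon> = char_vec M (Xs \<epsilon>)" for \<epsilon>
  have [measurable]: "p \<in> borel_measurable borel" using sq by (simp add: square_integrable_def p_def)
  have qm: "q \<epsilon> \<in> borel_measurable borel" if "\<epsilon> > 0" for \<epsilon>
    using sqs[OF that] by (simp add: square_integrable_def q_def)
  have ip: "integrable lborel (\<lambda>z. (norm (p z))\<^sup>2)" using sq by (simp add: square_integrable_def p_def)
  have iq: "integrable lborel (\<lambda>z. (norm (q \<epsilon> z))\<^sup>2)" if "\<epsilon> > 0" for \<epsilon>
    using sqs[OF that] by (simp add: square_integrable_def q_def)
  have idiff: "integrable lborel (\<lambda>z. (norm (p z - q \<epsilon> z))\<^sup>2)" if "\<epsilon> > 0" for \<epsilon>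
    unfolding p_def q_def by (rule square_integrable_diff[OF sq sqs[OF that]])
  have lim: "((\<lambda>\<epsilon>. q \<epsilon> z) \<longlongrightarrow> p z) (at_right 0)" for z
    unfolding p_def q_def
    by (rule conv_in_distr_imp_char_vec_tendsto[OF M _ X conv])
       (use Xs in \<open>auto simp: eventually_at_filter\<close>)
  have le1: "norm (p z) \<le> 1" "norm (q \<epsilon> z) \<le> 1" for z \<epsilon>
    unfolding p_def q_def by (simp_all add: norm_char_vec_le[OF M])
  have [measurable]: "ball 0 l \<in> sets (borel :: (real ^ 'd) measure)" for l by simp
  let ?T = "\<lambda>l. {z :: real ^ 'd. norm z \<ge> l}"
  have near: "((\<lambda>\<epsilon>. \<integral>z. indicator (ball 0 l) z * (norm (p z - q \<epsilon> z))\<^sup>2 \<partial>lborel) \<longlongrightarrow> 0) (at_right 0)" for l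
  \<comment> \<open>The one-sided limit is checked along positive sequences tending to 0, for which
    dominated convergence is applied.\<close>
  proof (rule tendsto_at_right_sequentially[of 0 1])
    fix S :: "nat \<Rightarrow> real" assume S: "\<And>n. 0 < S n" "S \<longlonglongrightarrow> 0"
    have "filterlim S (at_right 0) sequentially"
      using S S(1)[THEN less_imp_neq, THEN not_sym] by (simp add: filterlim_at)
    with lim have limS: "(\<lambda>n. q (S n) z) \<longlonglongrightarrow> p z" for z by (rule filterlim_compose)
    have "(\<lambda>n. \<integral>z. indicator (ball 0 l) z * (norm (p z - q (S n) z))\<^sup>2 \<partial>lborel) \<longlonglongrightarrow>
       (\<integral>z. indicator (ball 0 l) z * (norm (p z - p z))\<^sup>2 \<partial>lborel)"
    \<comment> \<open>4 = (1 + 1)^2, as both characteristic functions are bounded by 1.\<close>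
    proof (rule integral_dominated_convergence[where w="\<lambda>z. indicator (ball 0 l) z * 4"])
      show "integrable lborel (\<lambda>z::real^'d. indicator (ball 0 l) z * (4::real))"
        using emeasure_bounded_finite[OF bounded_ball, of "0 :: real ^ 'd" l] by simp
      show "AE z in lborel. (\<lambda>n. indicator (ball 0 l) z * (norm (p z - q (S n) z))\<^sup>2)
          \<longlonglongrightarrow> indicator (ball 0 l) z * (norm (p z - p z))\<^sup>2"
        by (intro AE_I2 tendsto_intros limS)
      have "(norm (p z - q (S n) z))\<^sup>2 \<le> 4" for n z
      proof -
        have "(norm (p z - q (S n) z))\<^sup>2 \<le> 2\<^sup>2"
          using norm_triangle_ineq4[of "p z" "q (S n) z"] le1(1)[of z] le1(2)[of "S n" z]
          by (intro power_mono) auto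
        then show ?thesis by simp
      qed
      then show "AE z in lborel. norm (indicator (ball 0 l) z * (norm (p z - q (S n) z))\<^sup>2) \<le> indicator (ball 0 l) z * 4" for n
        by (intro AE_I2) (simp add: indicator_def)
      show "(\<lambda>z. indicator (ball 0 l) z * (norm (p z - q (S n) z))\<^sup>2) \<in> borel_measurable lborel" for n
      proof -
        note [measurable] = qm[OF S(1)[of n]]
        show ?thesis by measurable
      qed
    qed simp
    then show "(\<lambda>n. \<integral>z. indicator (ball 0 l) z * (norm (p z - q (S n) z))\<^sup>2 \<partial>lborel) \<longlonglongrightarrow> 0" by simp
  qed simp
  have ptail: "((\<lambda>l. \<integral>z. indicator (?T l) z * (norm (p z))\<^sup>2 \<partial>lborel) \<longlongrightarrow> (\<integral>z. 0 \<partial>(lborel :: (real^'d) measure))) at_top"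
  proof (rule integral_dominated_convergence_at_top[OF _ _ ip])
    show "AE z in lborel. ((\<lambda>l. indicator (?T l) z * (norm (p z))\<^sup>2) \<longlongrightarrow> 0) at_top"
    proof (rule AE_I2)
      fix z :: "real ^ 'd"
      have "eventually (\<lambda>l. indicator (?T l) z * (norm (p z))\<^sup>2 = 0) at_top"
        using eventually_gt_at_top[of "norm z"] by eventually_elim (simp add: indicator_def)
      then show "((\<lambda>l. indicator (?T l) z * (norm (p z))\<^sup>2) \<longlongrightarrow> 0) at_top"
        by (rule tendsto_eventually)
    qed
    show "\<forall>\<^sub>F l in at_top. AE z in lborel. norm (indicator (?T l) z * (norm (p z))\<^sup>2) \<le> (norm (p z))\<^sup>2"
      by (simp add: indicator_def)
  qed simp_all
  show ?thesis
  proof (rule tendstoI)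
    fix e :: real assume "e > 0"
    \<comment> \<open>One d for the ball and 2 d for each of the two tails.\<close>
    define d where "d = e / 5"
    have d: "d > 0" using \<open>e > 0\<close> by (simp add: d_def)
    have "eventually (\<lambda>l. (\<integral>z. indicator (?T l) z * (norm (p z))\<^sup>2 \<partial>lborel) < d) at_top"
      using order_tendstoD(2)[OF ptail, of d] d by simp
    moreover have "eventually (\<lambda>l. Limsup (at_right 0) (\<lambda>\<epsilon>.
           \<integral>\<^sup>+z\<in>?T l. ennreal ((norm (q \<epsilon> z))\<^sup>2) \<partial>lborel) < ennreal d) at_top"
      using tail d unfolding q_def by (intro Limsup_lessD) simp
    ultimately obtain l where l1: "(\<integral>z. indicator (?T l) z * (norm (p z))\<^sup>2 \<partial>lborel) < d"
      and l2: "Limsup (at_right 0) (\<lambda>\<epsilon>. \<integral>\<^sup>+z\<in>?T l. ennreal ((norm (q \<epsilon> z))\<^sup>2) \<partial>lborel) < ennreal d"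
      using eventually_happens'[OF trivial_limit_at_top_linorder eventually_conj] by blast
    have "eventually (\<lambda>\<epsilon>. (\<integral>z. indicator (ball 0 l) z * (norm (p z - q \<epsilon> z))\<^sup>2 \<partial>lborel) < d) (at_right 0)"
      using order_tendstoD(2)[OF near d] .
    moreover have "eventually (\<lambda>\<epsilon>. (\<integral>\<^sup>+z\<in>?T l. ennreal ((norm (q \<epsilon> z))\<^sup>2) \<partial>lborel) < ennreal d) (at_right 0)"
      using l2 by (rule Limsup_lessD)
    moreover have "eventually (\<lambda>\<epsilon>::real. \<epsilon> > 0) (at_right 0)" by (rule eventually_at_right_less)
    ultimately show "eventually (\<lambda>\<epsilon>. dist (\<integral>z. (norm (char_vec M X z - char_vec M (Xs \<epsilon>) z))\<^sup>2 \<partial>lborel) 0 < e) (at_right 0)"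
    proof eventually_elim
      case (elim \<epsilon>)
      note [measurable] = qm[OF elim(3)]
      have ind: "integrable lborel (\<lambda>z. indicator A z * f z)" if "A \<in> sets borel" "integrable lborel f"
        for A :: "(real^'d) set" and f :: "real^'d \<Rightarrow> real"
        using integrable_mult_indicator[of A lborel f] that by simp
      have "(\<integral>\<^sup>+z\<in>?T l. ennreal ((norm (q \<epsilon> z))\<^sup>2) \<partial>lborel) =
          (\<integral>\<^sup>+z. ennreal (indicator (?T l) z * (norm (q \<epsilon> z))\<^sup>2) \<partial>lborel)"
        by (intro nn_integral_cong) (simp add: indicator_def)
      also have "\<dots> = ennreal (\<integral>z. indicator (?T l) z * (norm (q \<epsilon> z))\<^sup>2 \<partial>lborel)"
        by (intro nn_integral_eq_integral ind iq[OF elim(3)]) auto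
      finally have l3: "(\<integral>z. indicator (?T l) z * (norm (q \<epsilon> z))\<^sup>2 \<partial>lborel) < d"
        using elim(2) d by (simp add: ennreal_less_iff)
      have "(\<integral>z. (norm (p z - q \<epsilon> z))\<^sup>2 \<partial>lborel) \<le>
          (\<integral>z. indicator (ball 0 l) z * (norm (p z - q \<epsilon> z))\<^sup>2 +
             (2 * (indicator (?T l) z * (norm (p z))\<^sup>2) + 2 * (indicator (?T l) z * (norm (q \<epsilon> z))\<^sup>2)) \<partial>lborel)"
      proof (intro integral_mono idiff elim Bochner_Integration.integrable_add integrable_mult_right ind iq ip)
        fix z
        show "(norm (p z - q \<epsilon> z))\<^sup>2 \<le> indicator (ball 0 l) z * (norm (p z - q \<epsilon> z))\<^sup>2 +
             (2 * (indicator (?T l) z * (norm (p z))\<^sup>2) + 2 * (indicator (?T l) z * (norm (q \<epsilon> z))\<^sup>2))"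
          using norm_diff_sq_le[of "p z" "q \<epsilon> z"] by (cases "norm z < l") (simp_all add: indicator_def)
      qed simp_all
      also have "\<dots> = (\<integral>z. indicator (ball 0 l) z * (norm (p z - q \<epsilon> z))\<^sup>2 \<partial>lborel) +
          (2 * (\<integral>z. indicator (?T l) z * (norm (p z))\<^sup>2 \<partial>lborel) + 2 * (\<integral>z. indicator (?T l) z * (norm (q \<epsilon> z))\<^sup>2 \<partial>lborel))"
        by (intro has_bochner_integral_integral_eq has_bochner_integral_add has_bochner_integral_mult_right
            has_bochner_integral_integrable ind idiff iq ip elim) simp_all
      also have "\<dots> < e"
        using elim(1) l1 l3 by (simp add: d_def)
      finally show ?case by (simp add: p_def q_def)
    qed
  qed
qed

section \<open>From the L2 distance to total variation\<close>

theorem propositionA5: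
  fixes M :: "'w measure"
    and Xs :: "real \<Rightarrow> 'w \<Rightarrow> real ^ 'd"
    and X :: "'w \<Rightarrow> real ^ 'd"
  assumes "prob_space M"
    and "\<And>\<epsilon>. \<epsilon> > 0 \<Longrightarrow> Xs \<epsilon> \<in> borel_measurable M"
    and "X \<in> borel_measurable M"
    and "conv_in_distr M Xs X (at_right 0)"
    and "square_integrable (char_vec M X)"
    and "\<And>\<epsilon>. \<epsilon> > 0 \<Longrightarrow> square_integrable (char_vec M (Xs \<epsilon>))"
    and "Limsup at_top (\<lambda>l::real. Limsup (at_right 0) (\<lambda>\<epsilon>.
           \<integral>\<^sup>+z\<in>{z. norm z \<ge> l}. ennreal ((norm (char_vec M (Xs \<epsilon>) z))\<^sup>2) \<partial>lborel)) = 0"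
  shows "((\<lambda>\<epsilon>. tv_dist (distr M borel (Xs \<epsilon>)) (distr M borel X)) \<longlongrightarrow> 0) (at_right 0)"
proof (rule tendstoI)
  fix e :: real assume e: "e > 0"
  interpret prob_space M by fact
  define \<mu> where "\<mu> = distr M borel X"
  define \<nu> where "\<nu> \<epsilon> = distr M borel (Xs \<epsilon>)" for \<epsilon>
  define D where "D \<epsilon> = (\<integral>z. (norm (char_vec M X z - char_vec M (Xs \<epsilon>) z))\<^sup>2 \<partial>lborel)" for \<epsilon>
  have sets [measurable_cong, simp]: "sets \<mu> = sets borel" "sets (\<nu> \<epsilon>) = sets borel" for \<epsilon>
    by (simp_all add: \<mu>_def \<nu>_def)
  have mu: "prob_space \<mu>" unfolding \<mu>_def using assms(3) by (rule prob_space_distr)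
  interpret mu: prob_space \<mu> by (rule mu)
  \<comment> \<open>The ball depends on the limit law only and is fixed before epsilon.\<close>
  obtain R :: real where R: "measure \<mu> (- cball 0 R) < e / 2"
  proof -
    have sp: "space \<mu> = UNIV" by (simp add: \<mu>_def)
    have "(\<Union>n. cball 0 (real n)) = (UNIV :: (real ^ 'd) set)"
      using real_arch_simple by auto
    moreover have "(\<lambda>n. measure \<mu> (cball 0 (real n))) \<longlonglongrightarrow> measure \<mu> (\<Union>n. cball 0 (real n))"
      by (intro mu.finite_Lim_measure_incseq) (auto simp: incseq_def)
    ultimately have "(\<lambda>n. measure \<mu> (cball 0 (real n))) \<longlonglongrightarrow> 1"
      using mu.prob_space sp by simp
    from order_tendstoD(1)[OF this, of "1 - e / 2"] e
    obtain n where "1 - e / 2 < measure \<mu> (cball 0 (real n))"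
      by (auto simp: eventually_sequentially)
    moreover have "measure \<mu> (- cball 0 (real n)) = 1 - measure \<mu> (cball 0 (real n))"
      using mu.prob_compl[of "cball 0 (real n)"] by (simp add: sp Compl_eq_Diff_UNIV)
    ultimately show thesis using that[of "real n"] by simp
  qed
  \<comment> \<open>Chosen so that c times the volume of the ball is at most e / 2; the added 1
    covers a ball of volume 0. Once D < c e / 2, the right-hand side of the estimate is below e,
    hence the difference on the ball is below e / 2.\<close>
  define c where "c = e / 2 / (measure lborel (cball (0 :: real ^ 'd) R) + 1)"
  have c: "c > 0" using e by (simp add: c_def add_nonneg_pos)
  have cvol: "c * measure lborel (cball (0 :: real ^ 'd) R) \<le> e / 2"
  proof -
    have "v / (v + 1) \<le> 1" if "v \<ge> 0" for v :: real
      using that by simp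
    from mult_left_mono[OF this[OF measure_nonneg], of "e / 2"] e show ?thesis
      by (simp add: c_def)
  qed
  have "(D \<longlongrightarrow> 0) (at_right 0)"
    unfolding D_def by (rule L2_tendsto_char_vec[OF assms])
  then have "eventually (\<lambda>\<epsilon>. D \<epsilon> < c * e / 2) (at_right 0)"
    using c e by (intro order_tendstoD) auto
  moreover have "eventually (\<lambda>\<epsilon>::real. \<epsilon> > 0) (at_right 0)" by (rule eventually_at_right_less)
  ultimately show "eventually (\<lambda>\<epsilon>. dist (tv_dist (distr M borel (Xs \<epsilon>)) (distr M borel X)) 0 < e) (at_right 0)"
  proof eventually_elim
    case (elim \<epsilon>)
    have nu: "prob_space (\<nu> \<epsilon>)" unfolding \<nu>_def using assms(2)[OF elim(2)] by (rule prob_space_distr)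
    interpret nu: prob_space "\<nu> \<epsilon>" by (rule nu)
    \<comment> \<open>The limit law is put second, so that A is a set where it exceeds the other law
      and its own tail bounds the loss.\<close>
    obtain A where A [measurable]: "A \<in> sets borel"
      and tv: "0 \<le> tv_dist (\<nu> \<epsilon>) \<mu>" "tv_dist (\<nu> \<epsilon>) \<mu> \<le> measure \<mu> A - measure (\<nu> \<epsilon>) A"
      using tv_dist_le_measure_diff[OF nu mu] by (metis sets)
    let ?B = "A \<inter> cball 0 R"
    have "2 * (measure \<mu> ?B - measure (\<nu> \<epsilon>) ?B) \<le> c * measure lborel ?B + D \<epsilon> / c"
      using measure_diff_le_char_vec[OF mu nu sets _ _ _ c, where A="?B"] A
        square_integrable_diff[OF assms(5) assms(6)[OF elim(2)]]
      by (simp add: bounded_Int \<mu>_def \<nu>_def char_vec_distr assms(2)[OF elim(2)] assms(3) D_def)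
    also have "c * measure lborel ?B \<le> c * measure lborel (cball (0 :: real ^ 'd) R)"
      using c emeasure_bounded_finite[OF bounded_cball, of "0 :: real ^ 'd" R]
      by (intro mult_left_mono measure_mono_fmeasurable) (auto simp: fmeasurable_def)
    also note cvol
    also have "D \<epsilon> / c < e / 2" using elim(1) c by (simp add: field_simps)
    finally have B: "measure \<mu> ?B - measure (\<nu> \<epsilon>) ?B < e / 2" by simp
    \<comment> \<open>Cutting A down to the ball costs at most the tail of mu and can only decrease
      the subtracted mass of nu.\<close>
    have "measure \<mu> A \<le> measure \<mu> ?B + measure \<mu> (- cball 0 R)"
      by (rule order_trans[OF mu.finite_measure_mono measure_Un_le]) auto
    moreover have "measure (\<nu> \<epsilon>) ?B \<le> measure (\<nu> \<epsilon>) A"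
      by (intro nu.finite_measure_mono) auto
    ultimately show ?case
      using tv B R by (simp add: \<mu>_def \<nu>_def)
  qed
qed

end
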